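(* (1) No order-based semantics is $\ast$-composable. (2) No identifier-independent, unbounded, filter-based semantics is $\ast$-composable.
   Context: Fix pairwise disjoint countably infinite sets $\mathbb V$ (vertex identifiers), $\mathbb E$ (edge identifiers), $\mathbb L$ (labels). Regular expressions are given by $R ::= \varepsilon \mid a \mid R^* \mid R\cdot R\mid R+R$ with $a\in\mathbb L$; $L(R)$ is the denoted language. A walk is a finite nonempty alternating sequence $w=(v_0,e_1,v_1,\dots,e_k,v_k)$ with $v_i\in\mathbb V$, $e_i\in\mathbb E$; its length is $k$ and its endpoints are the pair $(v_0,v_k)$. $\mathsf{Walks}$ is the set of all walks (independently of any database). Walks $w$ and $w'$ concatenate if the last vertex of $w$ is the first vertex of $w'$; then $w\cdot w'$ is obtained by joining them with the shared vertex written once. A database $D=(L_D,V_D,E_D,\mathsf{Src}_D,\mathsf{Tgt}_D,\mathsf{Lbl}_D)$ consists of finite sets $L_D\subset\mathbb L$, $V_D\subset\mathbb V$, $E_D\subset\mathbb E$ and functions $\mathsf{Src}_D,\mathsf{Tgt}_D:E_D\to V_D$, $\mathsf{Lbl}_D:E_D\to L_D$. $\mathsf{Walks}(D)$ is the set of walks $(v_0,e_1,\dots,e_k,v_k)$ with all $v_i\in V_D$, $e_i\in E_D$, $\mathsf{Src}_D(e_i)=v_{i-1}$ and $\mathsf{Tgt}_D(e_i)=v_i$; the label $\mathsf{Lbl}_D(w)$ of such a walk is the word $\mathsf{Lbl}_D(e_1)\cdots\mathsf{Lbl}_D(e_k)$. $\mathsf{Matches}(D,R)=\{w\in\mathsf{Walks}(D):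 \mathsf{Lbl}_D(w)\in L(R)\}$, and $\mathsf{Matches}(D,R,s,t)$ is the set of those $w\in \mathsf{Matches}(D,R)$ with endpoints $(s,t)$. For a set $W\subseteq\mathsf{Walks}(D)$, $W^*$ is the set of all walks $w_1\cdot w_2\cdots w_k$, where every $w_i\in W$ and consecutive walks concatenate, $k\geq 0$, the case $k=0$ contributing all walks of length $0$ in $D$. A semantics $S$ is a function mapping every database $D$ and regular expression $R$ to a finite subset $S(D,R)$ of $\mathsf{Matches}(D,R)$. $S$ is filter-based if there is a function $f:\mathsf{Walks}\to\{\top,\bot\}$ with $S(D,R)=\{w\in\mathsf{Matches}(D,R): f(w)=\top\}$ for all $D,R$. A partial order $\preceq$ on $\mathsf{Walks}$ is suitable if for every database $D$ its restriction to $\mathsf{Walks}(D)$ is a well-partial-order (every infinite sequence $x_1,x_2,\dots$ has $i<j$ with $x_i\preceq x_j$). $S$ is order-based if there is a suitable order $\preceq$ with $S(D,R)=\bigcup_{s,t\in V_D}\min_\preceq \mathsf{Matches}(D,R,s,t)$ for all $D,R$, where $\min_\preceq X$ is the set of $\preceq$-minimal elements of $X$. A renaming is a permutation $\nu$ of $\mathbb V\cup\mathbb E$ with $\nu(\mathbb V)=\mathbb V$ and $\nu(\mathbb E)=\mathbb E$; it acts on walks elementwise and on databases by renaming vertices and edges (transporting source, target and label functions along $\nu$). $S$ is identifier-independent if $\nu(S(D,R))=S(\nu(D),R)$ for every renaming $\nu$, database $D$ and regular expression $R$. $S$ is unbounded if for every integer $n$ there are $D,R$ such that $S(D,R)$ contains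 a walk of length at least $n$. $S$ is $\ast$-composable if $S(D,R^* )\supseteq (S(D,R))^*$ for all databases $D$ and regular expressions $R$. *)

theory Defs
  imports Main "HOL-Library.FuncSet" "HOL-Library.Countable" "HOL-Library.Infinite_Typeclass"
begin

(* Vertex identifiers, edge identifiers and labels are the elements of three type parameters
   'v, 'e, 'l (countable and infinite in the theorem).  Distinct type parameters play the role of
   pairwise disjoint sets. *)

datatype 'l rexp =
    Eps
  | Atom 'l
  | Star "'l rexp"
  | Times "'l rexp" "'l rexp"
  | Plus "'l rexp" "'l rexp"

primrec lang :: "'l rexp \<Rightarrow> 'l list set" where
  "lang Eps = {[]}"
| "lang (Atom a) = {[a]}"
| "lang (Star r) = concat ` lists (lang r)"
| "lang (Times r s) = {x @ y | x y. x \<in> lang r \<and> y \<in> lang s}"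
| "lang (Plus r s) = lang r \<union> lang s"

(* Walk v0 [(e1, v1), ..., (ek, vk)] is the walk (v0, e1, v1, ..., ek, vk). *)
datatype ('v, 'e) walk = Walk (start: 'v) (steps: "('e \<times> 'v) list")

definition walk_verts :: "('v, 'e) walk \<Rightarrow> 'v list" where
  "walk_verts w = start w # map snd (steps w)"

definition walk_edges :: "('v, 'e) walk \<Rightarrow> 'e list" where
  "walk_edges w = map fst (steps w)"

definition walk_length :: "('v, 'e) walk \<Rightarrow> nat" where
  "walk_length w = length (walk_edges w)"

definition finish :: "('v, 'e) walk \<Rightarrow> 'v" where
  "finish w = last (walk_verts w)"

definition concatenates :: "('v, 'e) walk \<Rightarrow> ('v, 'e) walk \<Rightarrow> bool" where
  "concatenates w w' \<longleftrightarrow> finish w = start w'"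

(* Only meaningful when concatenates w w' holds. *)
definition walk_append :: "('v, 'e) walk \<Rightarrow> ('v, 'e) walk \<Rightarrow> ('v, 'e) walk" where
  "walk_append w w' = Walk (start w) (steps w @ steps w')"

record ('v, 'e, 'l) db =
  db_labels :: "'l set"
  db_verts :: "'v set"
  db_edges :: "'e set"
  db_src :: "'e \<Rightarrow> 'v"
  db_tgt :: "'e \<Rightarrow> 'v"
  db_lbl :: "'e \<Rightarrow> 'l"

(* The extensional function spaces fix the values outside db_edges D, so that equality of records
   is equality of databases. *)
definition database :: "('v, 'e, 'l) db \<Rightarrow> bool" where
  "database D \<longleftrightarrow>
     finite (db_labels D) \<and> finite (db_verts D) \<and> finite (db_edges D) \<and>
     db_src D \<in> db_edges D \<rightarrow>\<^sub>E db_verts D \<and>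
     db_tgt D \<in> db_edges D \<rightarrow>\<^sub>E db_verts D \<and>
     db_lbl D \<in> db_edges D \<rightarrow>\<^sub>E db_labels D"

definition walks :: "('v, 'e, 'l) db \<Rightarrow> ('v, 'e) walk set" where
  "walks D = {w. set (walk_verts w) \<subseteq> db_verts D \<and> set (walk_edges w) \<subseteq> db_edges D \<and>
     (\<forall>i < walk_length w.
        db_src D (walk_edges w ! i) = walk_verts w ! i \<and>
        db_tgt D (walk_edges w ! i) = walk_verts w ! Suc i)}"

definition walk_label :: "('v, 'e, 'l) db \<Rightarrow> ('v, 'e) walk \<Rightarrow> 'l list" where
  "walk_label D w = map (db_lbl D) (walk_edges w)"

definition matches :: "('v, 'e, 'l) db \<Rightarrow> 'l rexp \<Rightarrow> ('v, 'e) walk set" where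
  "matches D R = {w \<in> walks D. walk_label D w \<in> lang R}"

definition matches_between ::
    "('v, 'e, 'l) db \<Rightarrow> 'l rexp \<Rightarrow> 'v \<Rightarrow> 'v \<Rightarrow> ('v, 'e) walk set" where
  "matches_between D R s t = {w \<in> matches D R. start w = s \<and> finish w = t}"

(* The first set is the contribution of k = 0, the second that of k >= 1. *)
definition walk_star :: "('v, 'e, 'l) db \<Rightarrow> ('v, 'e) walk set \<Rightarrow> ('v, 'e) walk set" where
  "walk_star D W =
     {w \<in> walks D. walk_length w = 0} \<union>
     {foldl walk_append w ws | w ws. set (w # ws) \<subseteq> W \<and> successively concatenates (w # ws)}"

type_synonym ('v, 'e, 'l) sem = "('v, 'e, 'l) db \<Rightarrow> 'l rexp \<Rightarrow> ('v, 'e) walk set"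

definition semantics :: "('v, 'e, 'l) sem \<Rightarrow> bool" where
  "semantics S \<longleftrightarrow> (\<forall>D R. database D \<longrightarrow> finite (S D R) \<and> S D R \<subseteq> matches D R)"

definition filter_based :: "('v, 'e, 'l) sem \<Rightarrow> bool" where
  "filter_based S \<longleftrightarrow>
     (\<exists>f :: ('v, 'e) walk \<Rightarrow> bool. \<forall>D R. database D \<longrightarrow> S D R = {w \<in> matches D R. f w})"

definition well_partial_order_on :: "'a set \<Rightarrow> 'a rel \<Rightarrow> bool" where
  "well_partial_order_on A r \<longleftrightarrow>
     partial_order_on A r \<and>
     (\<forall>x :: nat \<Rightarrow> 'a. range x \<subseteq> A \<longrightarrow> (\<exists>i j. i < j \<and> (x i, x j) \<in> r))"

(* The label type does not occur in r, hence the explicit type argument. *)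
definition suitable :: "'l itself \<Rightarrow> ('v, 'e) walk rel \<Rightarrow> bool" where
  "suitable _ r \<longleftrightarrow>
     partial_order_on UNIV r \<and>
     (\<forall>D :: ('v, 'e, 'l) db. database D \<longrightarrow> well_partial_order_on (walks D) (Restr r (walks D)))"

definition minimal_elements :: "'a rel \<Rightarrow> 'a set \<Rightarrow> 'a set" where
  "minimal_elements r X = {x \<in> X. \<forall>y \<in> X. (y, x) \<in> r \<longrightarrow> y = x}"

definition order_based :: "('v, 'e, 'l) sem \<Rightarrow> bool" where
  "order_based S \<longleftrightarrow>
     (\<exists>r. suitable TYPE('l) r \<and>
       (\<forall>D R. database D \<longrightarrow>
          S D R = (\<Union>s \<in> db_verts D. \<Union>t \<in> db_verts D.
                     minimal_elements r (matches_between D R s t))))"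

(* The sum type 'v + 'e is the disjoint union of vertex and edge identifiers. *)
definition renaming :: "('v + 'e \<Rightarrow> 'v + 'e) \<Rightarrow> bool" where
  "renaming \<nu> \<longleftrightarrow> bij \<nu> \<and> \<nu> ` range Inl = range Inl \<and> \<nu> ` range Inr = range Inr"

definition ren_vert :: "('v + 'e \<Rightarrow> 'v + 'e) \<Rightarrow> 'v \<Rightarrow> 'v" where
  "ren_vert \<nu> v = projl (\<nu> (Inl v))"

definition ren_edge :: "('v + 'e \<Rightarrow> 'v + 'e) \<Rightarrow> 'e \<Rightarrow> 'e" where
  "ren_edge \<nu> e = projr (\<nu> (Inr e))"

definition ren_walk :: "('v + 'e \<Rightarrow> 'v + 'e) \<Rightarrow> ('v, 'e) walk \<Rightarrow> ('v, 'e) walk" where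
  "ren_walk \<nu> = map_walk (ren_vert \<nu>) (ren_edge \<nu>)"

definition ren_db :: "('v + 'e \<Rightarrow> 'v + 'e) \<Rightarrow> ('v, 'e, 'l) db \<Rightarrow> ('v, 'e, 'l) db" where
  "ren_db \<nu> D =
     (let E = ren_edge \<nu> ` db_edges D; old = inv (ren_edge \<nu>) in
      \<lparr> db_labels = db_labels D,
        db_verts = ren_vert \<nu> ` db_verts D,
        db_edges = E,
        db_src = (\<lambda>e \<in> E. ren_vert \<nu> (db_src D (old e))),
        db_tgt = (\<lambda>e \<in> E. ren_vert \<nu> (db_tgt D (old e))),
        db_lbl = (\<lambda>e \<in> E. db_lbl D (old e)) \<rparr>)"

definition identifier_independent :: "('v, 'e, 'l) sem \<Rightarrow> bool" where
  "identifier_independent S \<longleftrightarrow>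
     (\<forall>\<nu> D R. renaming \<nu> \<and> database D \<longrightarrow> ren_walk \<nu> ` S D R = S (ren_db \<nu> D) R)"

definition unbounded :: "('v, 'e, 'l) sem \<Rightarrow> bool" where
  "unbounded S \<longleftrightarrow>
     (\<forall>n :: int. \<exists>D R. database D \<and> (\<exists>w \<in> S D R. n \<le> int (walk_length w)))"

definition star_composable :: "('v, 'e, 'l) sem \<Rightarrow> bool" where
  "star_composable S \<longleftrightarrow>
     (\<forall>D R. database D \<longrightarrow> walk_star D (S D R) \<subseteq> S D (Star R))"

end

(* If a composable semantics returned a walk u from s to t and a walk w from t to s for the same
   expression R, not both of length 0, it would return all walks (u w)^k for R*, which are infinitely
   many.  For an order-based semantics, a database with a single vertex and a single loop gives such
   walks, with u = w.  For an unbounded filter-based semantics, take a returned nonempty walk u from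
   s to t in D, and rename it by swapping s and t and replacing all edges by fresh ones.  By identifier
   independence the copy w passes the filter, and the union of D with its renamed copy contains both
   u and w, with the same label. *)

theory Submission
  imports Defs "HOL-Combinatorics.Transposition"
begin

lemma walk_length_eq: "walk_length w = length (steps w)"
  by (simp add: walk_length_def walk_edges_def)

lemma walk_length_foldl_append:
  "walk_length (foldl walk_append w ws) = walk_length w + sum_list (map walk_length ws)"
  by (induction ws arbitrary: w) (auto simp: walk_append_def walk_length_eq)

lemma successively_alternate:
  assumes "P x y" "P y x"
  shows "successively P (x # y # concat (replicate k [x, y]))"
  using assms by (induction k) auto

text \<open>Alternating \<open>u\<close> and \<open>w\<close> produces products whose lengths are
  distinct multiples of the positive length of \<open>u w\<close>, so infinitely many of them are
  different.\<close>

lemma infinite_walk_star: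
  assumes "u \<in> W" "w \<in> W" "concatenates u w" "concatenates w u" "0 < walk_length u"
  shows "infinite (walk_star D W)"
proof -
  \<comment> \<open>The fold starts from the first factor \<open>u\<close>, so
    \<open>power k\<close> is the power of \<open>u w\<close> with exponent k + 1.\<close>
  define power where "power k = foldl walk_append u (w # concat (replicate k [u, w]))" for k
  have len: "walk_length (power k) = Suc k * (walk_length u + walk_length w)" for k
  proof -
    have "sum_list (map walk_length (concat (replicate k [u, w]))) =
        k * (walk_length u + walk_length w)"
      by (induction k) auto
    then show ?thesis
      by (simp add: power_def walk_length_foldl_append del: foldl_Cons)
  qed
  have "inj power"
    using len assms(5) by (intro injI) (metis Suc_inject add_gr_0 mult_cancel2 nat_neq_iff)
  moreover have "range power \<subseteq> walk_star D W"
  proof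
    fix x assume "x \<in> range power"
    then obtain k where x: "x = power k"
      by auto
    have "successively concatenates (u # w # concat (replicate k [u, w]))"
      by (rule successively_alternate) fact+
    moreover have "set (u # w # concat (replicate k [u, w])) \<subseteq> W"
      using assms by auto
    ultimately show "x \<in> walk_star D W"
      unfolding walk_star_def x power_def by blast
  qed
  ultimately show ?thesis
    using finite_subset finite_imageD infinite_UNIV_nat by blast
qed

text \<open>Composability would embed the infinite star into \<open>S D (Star R)\<close>, a finite
  set for any semantics.\<close>

lemma not_star_composable_if_cycle:
  assumes "semantics S" "database D" "u \<in> S D R" "w \<in> S D R"
    and "concatenates u w" "concatenates w u" "0 < walk_length u"
  shows "\<not> star_composable S"
  using assms infinite_walk_star[of u "S D R" w D]
  unfolding star_composable_def semantics_def by (meson finite_subset)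

lemma order_based_not_star_composable:
  fixes S :: "('v, 'e, 'l) sem"
  assumes "semantics S" "order_based S"
  shows "\<not> star_composable S"
proof -
  \<comment> \<open>Types are nonempty, so these can be chosen arbitrarily although the goal does
    not mention them.\<close>
  fix v :: 'v and e :: 'e and a :: 'l
  define D where "D = \<lparr>db_labels = {a}, db_verts = {v}, db_edges = {e},
    db_src = (\<lambda>x\<in>{e}. v), db_tgt = (\<lambda>x\<in>{e}. v), db_lbl = (\<lambda>x\<in>{e}. a)\<rparr>"
  define loop where "loop = Walk v [(e, v)]"
  have D: "database D"
    by (auto simp: database_def D_def)
  have "x = loop" if "x \<in> matches D (Atom a)" for x
    using that
    by (cases x)
      (auto simp: matches_def walks_def walk_label_def walk_verts_def walk_edges_def D_def loop_def)
  moreover have "loop \<in> matches_between D (Atom a) v v"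
    by (auto simp: matches_between_def matches_def walks_def walk_label_def walk_verts_def
        walk_edges_def walk_length_def finish_def D_def loop_def)
  \<comment> \<open>The only element of a set is minimal for every relation \<open>r\<close>, so any
    order defining \<open>S\<close> selects \<open>loop\<close>.\<close>
  ultimately have "loop \<in> minimal_elements r (matches_between D (Atom a) v v)" for r
    by (auto simp: minimal_elements_def matches_between_def)
  moreover have "v \<in> db_verts D"
    by (simp add: D_def)
  ultimately have "loop \<in> S D (Atom a)"
    using assms(2) D unfolding order_based_def by blast
  moreover have "concatenates loop loop" "0 < walk_length loop"
    by (auto simp: concatenates_def finish_def walk_verts_def loop_def walk_length_eq)
  ultimately show ?thesis
    using not_star_composable_if_cycle assms(1) D by blast
qed

text \<open>On shared edges the data of \<open>D\<close> win, so matches of \<open>D\<close> always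
  survive, while those of \<open>D'\<close> survive once the edge sets are disjoint. Vertices may
  overlap.\<close>

definition db_union :: "('v, 'e, 'l) db \<Rightarrow> ('v, 'e, 'l) db \<Rightarrow> ('v, 'e, 'l) db" where
  "db_union D D' =
     \<lparr> db_labels = db_labels D \<union> db_labels D',
       db_verts = db_verts D \<union> db_verts D',
       db_edges = db_edges D \<union> db_edges D',
       db_src = override_on (db_src D') (db_src D) (db_edges D),
       db_tgt = override_on (db_tgt D') (db_tgt D) (db_edges D),
       db_lbl = override_on (db_lbl D') (db_lbl D) (db_edges D) \<rparr>"

lemma override_on_PiE:
  assumes "f \<in> A \<rightarrow>\<^sub>E B" "f' \<in> A' \<rightarrow>\<^sub>E B'"
  shows "override_on f' f A \<in> A \<union> A' \<rightarrow>\<^sub>E B \<union> B'"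
  using assms by (auto simp: override_on_def PiE_iff extensional_def)

lemma database_db_union:
  assumes "database D" "database D'"
  shows "database (db_union D D')"
  using assms unfolding database_def db_union_def by (simp add: override_on_PiE)

lemma matches_mono:
  assumes "db_verts D \<subseteq> db_verts D'" "db_edges D \<subseteq> db_edges D'"
    and "\<And>e. e \<in> db_edges D \<Longrightarrow>
      db_src D' e = db_src D e \<and> db_tgt D' e = db_tgt D e \<and> db_lbl D' e = db_lbl D e"
  shows "matches D R \<subseteq> matches D' R"
proof
  fix w assume w: "w \<in> matches D R"
  then have edges: "set (walk_edges w) \<subseteq> db_edges D"
    by (simp add: matches_def walks_def)
  then have "walk_edges w ! i \<in> db_edges D" if "i < walk_length w" for i
    using that by (auto simp: walk_length_def)
  then have "w \<in> walks D'"
    using w assms by (auto simp: matches_def walks_def)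
  moreover have "walk_label D' w = walk_label D w"
    using edges assms(3) by (auto simp: walk_label_def)
  ultimately show "w \<in> matches D' R"
    using w by (simp add: matches_def)
qed

lemma matches_db_union1: "matches D R \<subseteq> matches (db_union D D') R"
  by (rule matches_mono) (auto simp: db_union_def)

lemma matches_db_union2:
  assumes "db_edges D \<inter> db_edges D' = {}"
  shows "matches D' R \<subseteq> matches (db_union D D') R"
  by (rule matches_mono) (use assms in \<open>auto simp: db_union_def override_on_def\<close>)

lemma database_ren_db:
  assumes "database D" "inj (ren_edge \<nu>)"
  shows "database (ren_db \<nu> D)"
  using assms by (auto simp: database_def ren_db_def Let_def)

lemma db_edges_ren_db: "db_edges (ren_db \<nu> D) = ren_edge \<nu> ` db_edges D"
  by (simp add: ren_db_def Let_def)

lemma start_ren_walk: "start (ren_walk \<nu> w) = ren_vert \<nu> (start w)"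
  by (simp add: ren_walk_def walk.map_sel)

lemma finish_ren_walk: "finish (ren_walk \<nu> w) = ren_vert \<nu> (finish w)"
  by (cases w) (simp add: ren_walk_def finish_def walk_verts_def last_map flip: map_map
      add: comp_def)

lemma renaming_map_sum:
  assumes "bij f" "bij g"
  shows "renaming (map_sum f g)"
proof -
  have "surj f" "surj g"
    using assms by (auto simp: bij_def)
  have "map_sum f g ` range Inl = Inl ` range f" "map_sum f g ` range Inr = Inr ` range g"
    by (simp_all add: image_image)
  then have ranges: "map_sum f g ` range Inl = range Inl" "map_sum f g ` range Inr = range Inr"
    by (simp_all add: \<open>surj f\<close> \<open>surj g\<close>)
  have "inj (map_sum f g)"
    using assms by (simp add: bij_def sum.inj_map)
  moreover have "surj (map_sum f g)"
    by (metis ranges UNIV_sum image_Un)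
  ultimately show ?thesis
    using ranges by (simp add: renaming_def bij_def)
qed

text \<open>An infinite type has room for a set \<open>B\<close> outside \<open>A\<close> with as
  many elements. Exchanging \<open>A\<close> and \<open>B\<close> along a bijection and fixing all
  other points is an involution, hence bijective.\<close>

lemma ex_bij_image_disjoint:
  fixes A :: "'a::infinite set"
  assumes "finite A"
  obtains p :: "'a \<Rightarrow> 'a" where "bij p" "A \<inter> p ` A = {}"
proof -
  have "infinite (- A)"
    using assms infinite_UNIV by (simp add: Compl_eq_Diff_UNIV)
  then obtain B where B: "finite B" "card B = card A" "B \<subseteq> - A"
    using infinite_arbitrarily_large by blast
  then obtain g where g: "bij_betw g A B"
    using assms finite_same_card_bij by metis
  define p where "p x = (if x \<in> A then g x else if x \<in> B then inv_into A g x else x)" for x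
  have gB: "g x \<in> B" if "x \<in> A" for x
    using g that by (auto simp: bij_betw_def)
  have "p (p x) = x" for x
    using g gB[of x] B(3)
      bij_betw_inv_into_left[OF g, of x] bij_betw_inv_into_right[OF g, of x]
      bij_betw_apply[OF bij_betw_inv_into[OF g], of x]
    by (auto simp: p_def)
  then have "bij p"
    by (rule involuntory_imp_bij)
  moreover have "A \<inter> p ` A = {}"
    using gB B(3) by (auto simp: p_def)
  ultimately show ?thesis
    by (rule that)
qed

lemma filter_based_not_star_composable:
  fixes S :: "('v, 'e::infinite, 'l) sem"
  assumes "semantics S" "identifier_independent S" "unbounded S" "filter_based S"
  shows "\<not> star_composable S"
proof -
  obtain f where f: "\<And>D R. database D \<Longrightarrow> S D R = {w \<in> matches D R. f w}"
    using assms(4) by (auto simp: filter_based_def)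
  obtain D R u where D: "database D" and u: "u \<in> S D R" "1 \<le> int (walk_length u)"
    using assms(3) unfolding unbounded_def by blast
  obtain p :: "'e \<Rightarrow> 'e" where p: "bij p" "db_edges D \<inter> p ` db_edges D = {}"
    using ex_bij_image_disjoint D unfolding database_def by blast
  \<comment> \<open>The transposition exchanges the endpoints of \<open>u\<close>, and is the
    identity if \<open>u\<close> is closed; \<open>p\<close> moves all edges of \<open>D\<close> to
    fresh ones.\<close>
  define \<nu> where "\<nu> = map_sum (transpose (start u) (finish u)) p"
  have vert: "ren_vert \<nu> = transpose (start u) (finish u)" and edge: "ren_edge \<nu> = p"
    by (auto simp: ren_vert_def ren_edge_def \<nu>_def)
  define w where "w = ren_walk \<nu> u"
  have D': "database (ren_db \<nu> D)"
    using D p(1) by (simp add: database_ren_db edge bij_is_inj)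
  have "renaming \<nu>"
    using p(1) by (simp add: \<nu>_def renaming_map_sum)
  then have "ren_walk \<nu> ` S D R = S (ren_db \<nu> D) R"
    using assms(2) D unfolding identifier_independent_def by blast
  then have w: "w \<in> S (ren_db \<nu> D) R"
    using u(1) w_def by blast
  let ?U = "db_union D (ren_db \<nu> D)"
  have U: "database ?U"
    using D D' by (rule database_db_union)
  have "db_edges D \<inter> db_edges (ren_db \<nu> D) = {}"
    using p(2) by (simp add: db_edges_ren_db edge)
  \<comment> \<open>The filter \<open>f\<close> sees only the walk and not the database: both walks
    passed it in their own databases and still match \<open>R\<close> in the union.\<close>
  then have "u \<in> S ?U R" "w \<in> S ?U R"
    using u(1) w matches_db_union1[of D R "ren_db \<nu> D"] matches_db_union2[of D "ren_db \<nu> D" R]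
    by (auto simp: f D D' U)
  moreover have "concatenates u w" "concatenates w u"
    by (simp_all add: concatenates_def w_def start_ren_walk finish_ren_walk vert)
  ultimately show ?thesis
    using not_star_composable_if_cycle[OF assms(1) U] u(2) by simp
qed

theorem lemma45:
  fixes S :: "('v::{countable,infinite}, 'e::{countable,infinite}, 'l::{countable,infinite}) sem"
  assumes "semantics S"
  shows "(order_based S \<longrightarrow> \<not> star_composable S) \<and>
    (identifier_independent S \<and> unbounded S \<and> filter_based S \<longrightarrow> \<not> star_composable S)"
  using assms order_based_not_star_composable filter_based_not_star_composable by blast

end
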